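(* Let $\sigma_\tau:\Sigma_{Z,S}\to\Sigma_{Z,S}$ be a full zip shift map. Then $\sigma_\tau$ has the shadowing property.
   Context: Full zip shift map: let $Z=\{a_1,\dots,a_k\}$ and $S=\{0,1,\dots,N-1\}$ be two collections of symbols with $N\ge k$, and let $\tau:S\to Z$ be a surjective map. To each $\bar t=(t_i)_{i\in\mathbb Z}\in\prod_{-\infty}^{+\infty}S$ corresponds a point $\bar x=(x_i)_{i\in\mathbb Z}$ with $x_i=t_i\in S$ for all $i\ge 0$ and $x_i=\tau(t_i)\in Z$ for all $i<0$; $\Sigma_{Z,S}$ is the set of all such $\bar x$. The zip shift map is defined by $(\sigma_\tau(\bar x))_i=x_{i+1}$ if $i\ne -1$, and $(\sigma_\tau(\bar x))_{-1}=\tau(x_0)$. The metric is $d(x,y)=1/\lambda^{M(x,y)}$ with $\lambda=\#(S)$, where $M(x,y)=\infty$ if $x=y$ and $M(x,y)=\min\{|i| : x_i\ne y_i\}$ if $x\ne y$. Shadowing property: let $(X,d)$ be a compact metric space and $f:X\to X$ a continuous dynamical system (local homeomorphism). A bi-sequence $\{x_n\}_{-\infty}^{+\infty}\subset X$ is a $\delta$-pseudo orbit if $d(f(x_n),x_{n+1})<\delta$ (for all $n\in\mathbb Z$). A $\delta$-pseudo orbit $\{x_n\}_{-\infty}^{+\infty}$ is $\epsilon$-traced (also called $\epsilon$-shadowed) by $y\in X$ if $d(f^n(y),x_n)<\epsilon$ for all $n\in\mathbb Z$. Since $f$ need not be invertible, negative iterates are understood as $f^{-n}(y)=(f^n)^{-1}(y)$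 for $n>0$. The map $f$ has the shadowing property (P.O.T.P.) if for any $\epsilon>0$ there exists some $\delta>0$ such that any $\delta$-pseudo orbit of $f$ is $\epsilon$-shadowed by some $y\in X$. *)

theory Defs
  imports Complex_Main "HOL-Library.Extended_Nat"
begin

text \<open>
  Shadowing for a map \<open>f\<close> on the carrier \<open>X\<close> with metric \<open>d\<close>. The setting is a compact metric
  space \<open>(X, d)\<close> and a continuous \<open>f\<close> from \<open>X\<close> to \<open>X\<close>, not assumed injective.
\<close>

definition pseudo_orbit ::
    "'p set \<Rightarrow> ('p \<Rightarrow> 'p \<Rightarrow> real) \<Rightarrow> ('p \<Rightarrow> 'p) \<Rightarrow> real \<Rightarrow> (int \<Rightarrow> 'p) \<Rightarrow> bool"
  where "pseudo_orbit X d f \<delta> x \<longleftrightarrow>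
    (\<forall>n. x n \<in> X) \<and> (\<forall>n. d (f (x n)) (x (n + 1)) < \<delta>)"

text \<open>
  For \<open>n < 0\<close> the iterate \<open>f\<^sup>n(y)\<close> is the full preimage of \<open>y\<close> in \<open>X\<close> under \<open>f\<^sup>-\<^sup>n\<close>, so iterates are
  set-valued throughout, being singletons for \<open>n \<ge> 0\<close>.
\<close>

definition int_iterate :: "'p set \<Rightarrow> ('p \<Rightarrow> 'p) \<Rightarrow> int \<Rightarrow> 'p \<Rightarrow> 'p set"
  where "int_iterate X f n y =
    (if n \<ge> 0 then {(f ^^ nat n) y} else {z \<in> X. (f ^^ nat (- n)) z = y})"

text \<open>
  The distance from a point to the set \<open>f\<^sup>n(y)\<close> is the usual infimum. It is below \<open>\<epsilon>\<close> iff some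
  element of the set is at distance below \<open>\<epsilon>\<close>; an empty preimage counts as not close.
\<close>

definition traced_by ::
    "'p set \<Rightarrow> ('p \<Rightarrow> 'p \<Rightarrow> real) \<Rightarrow> ('p \<Rightarrow> 'p) \<Rightarrow> real \<Rightarrow> (int \<Rightarrow> 'p) \<Rightarrow> 'p \<Rightarrow> bool"
  where "traced_by X d f \<epsilon> x y \<longleftrightarrow> (\<forall>n. \<exists>z \<in> int_iterate X f n y. d z (x n) < \<epsilon>)"

definition shadowing_property ::
    "'p set \<Rightarrow> ('p \<Rightarrow> 'p \<Rightarrow> real) \<Rightarrow> ('p \<Rightarrow> 'p) \<Rightarrow> bool"
  where "shadowing_property X d f \<longleftrightarrow>
    (\<forall>\<epsilon>>0. \<exists>\<delta>>0. \<forall>x. pseudo_orbit X d f \<delta> x \<longrightarrow> (\<exists>y\<in>X. traced_by X d f \<epsilon> x y))"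

text \<open>
  Zip shift. A point has entries in \<open>S\<close> (tagged \<open>Inl\<close>) at indices \<open>i \<ge> 0\<close> and entries in \<open>Z\<close>
  (tagged \<open>Inr\<close>) at indices \<open>i < 0\<close>. As \<open>Z\<close> is the image of \<open>S\<close> under \<open>\<tau>\<close>, it is not a separate
  parameter; values of \<open>\<tau>\<close> outside \<open>S\<close> play no role.
\<close>

definition zip_point :: "('s \<Rightarrow> 'z) \<Rightarrow> (int \<Rightarrow> 's) \<Rightarrow> int \<Rightarrow> 's + 'z"
  where "zip_point \<tau> t = (\<lambda>i. if i \<ge> 0 then Inl (t i) else Inr (\<tau> (t i)))"

definition zip_space :: "'s set \<Rightarrow> ('s \<Rightarrow> 'z) \<Rightarrow> (int \<Rightarrow> 's + 'z) set"
  where "zip_space S \<tau> = {zip_point \<tau> t | t. \<forall>i. t i \<in> S}"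

definition zip_shift :: "('s \<Rightarrow> 'z) \<Rightarrow> (int \<Rightarrow> 's + 'z) \<Rightarrow> int \<Rightarrow> 's + 'z"
  where "zip_shift \<tau> x = (\<lambda>i. if i \<noteq> - 1 then x (i + 1) else Inr (\<tau> (projl (x 0))))"

definition agreement_index :: "(int \<Rightarrow> 'b) \<Rightarrow> (int \<Rightarrow> 'b) \<Rightarrow> enat"
  where "agreement_index x y =
    (if x = y then \<infinity> else enat (LEAST m. \<exists>i. x i \<noteq> y i \<and> m = nat \<bar>i\<bar>))"

text \<open>\<open>1 / \<lambda>\<^sup>M\<close> with \<open>\<lambda> = card S\<close>, read as \<open>0\<close> for \<open>M = \<infinity>\<close> (also when \<open>\<lambda> = 1\<close>).\<close>

definition zip_dist :: "'s set \<Rightarrow> (int \<Rightarrow> 's + 'z) \<Rightarrow> (int \<Rightarrow> 's + 'z) \<Rightarrow> real"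
  where "zip_dist S x y =
    (case agreement_index x y of enat m \<Rightarrow> 1 / real (card S) ^ m | \<infinity> \<Rightarrow> 0)"

end

theory Submission
  imports Defs
begin

text \<open>
  The symbol at index \<open>0\<close> of \<open>x\<^sub>n\<close> always lies in \<open>S\<close>, so a bi-infinite sequence of points yields a
  bi-infinite sequence \<open>s\<^sub>n\<close> of symbols in \<open>S\<close>. The tracing point is \<open>y = zip_point \<tau> s\<close>.

  If consecutive points of a pseudo-orbit agree up to the shift on the window \<open>\<bar>i\<bar> \<le> m\<close>, every entry
  of \<open>x\<^sub>n\<close> in this window can be carried to index \<open>0\<close>, one step at a time, without leaving the
  window: an entry at index \<open>i \<ge> 0\<close> reaches index \<open>0\<close> of \<open>x\<^sub>n\<^sub>+\<^sub>i\<close> by going forward in time, and an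
  entry at index \<open>i < 0\<close> goes backward in time to the index \<open>- 1\<close> where it was produced by applying
  \<open>\<tau>\<close> to the entry at index \<open>0\<close> of \<open>x\<^sub>n\<^sub>+\<^sub>i\<close>. Hence \<open>x\<^sub>n\<close> agrees on the window with
  \<open>zip_point \<tau> (\<lambda>i. s\<^sub>n\<^sub>+\<^sub>i)\<close> (\<open>pseudo_orbit_entries\<close>).

  These points form a true orbit through \<open>y\<close> (\<open>funpow_zip_shift_zip_point\<close>). For \<open>n < 0\<close> they
  select from the many preimages of \<open>y\<close> the one lying close to \<open>x\<^sub>n\<close>, so the failure of injectivity
  does no harm. It remains to translate between small distance and agreement on a window, which
  is done in \<open>zip_dist_less_imp_agree\<close> and \<open>agree_imp_zip_dist_less\<close>.
\<close>

section \<open>Distance and agreement on windows\<close>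

lemma agreement_index_le:
  assumes "x i \<noteq> y i"
  shows "agreement_index x y \<le> enat (nat \<bar>i\<bar>)"
proof -
  have "(LEAST m. \<exists>i. x i \<noteq> y i \<and> m = nat \<bar>i\<bar>) \<le> nat \<bar>i\<bar>"
    using assms by (intro Least_le) blast
  with assms show ?thesis by (auto simp: agreement_index_def)
qed

lemma agreement_index_attained:
  assumes "x \<noteq> y"
  obtains i where "x i \<noteq> y i" "agreement_index x y = enat (nat \<bar>i\<bar>)"
proof -
  have "\<exists>m i. x i \<noteq> y i \<and> m = nat \<bar>i\<bar>" using assms by (auto simp: fun_eq_iff)
  then have "\<exists>i. x i \<noteq> y i \<and> (LEAST m. \<exists>i. x i \<noteq> y i \<and> m = nat \<bar>i\<bar>) = nat \<bar>i\<bar>"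
    by (rule LeastI_ex)
  with assms that show thesis by (auto simp: agreement_index_def)
qed

lemma zip_dist_less_imp_agree:
  assumes "0 < card S" and "zip_dist S x y < 1 / real (card S) ^ m" and "\<bar>i\<bar> \<le> int m"
  shows "x i = y i"
proof (rule ccontr)
  assume "x i \<noteq> y i"
  from agreement_index_le[of x i y, OF this]
  obtain j where j: "agreement_index x y = enat j" "j \<le> nat \<bar>i\<bar>"
    by (cases "agreement_index x y") auto
  then have "j \<le> m" using assms(3) by linarith
  then have "real (card S) ^ j \<le> real (card S) ^ m"
    using assms(1) by (intro power_increasing) auto
  then have "1 / real (card S) ^ m \<le> zip_dist S x y"
    using assms(1) j by (simp add: zip_dist_def frac_le)
  with assms(2) show False by simp
qed

text \<open>
  For \<open>card S \<ge> 2\<close> the window is chosen so that \<open>1 / \<lambda>\<^sup>m < \<epsilon>\<close>. For a one-letter alphabet no choice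
  of \<open>m\<close> makes \<open>1 / \<lambda>\<^sup>m\<close> small, but the space is then a single point and all distances vanish; this
  is why the two points are required to lie in the space.
\<close>

lemma agree_imp_zip_dist_less:
  fixes S :: "'s set" and \<tau> :: "'s \<Rightarrow> 'z"
  assumes "0 < card S" and "0 < \<epsilon>"
  obtains m where "\<And>x y. \<lbrakk>x \<in> zip_space S \<tau>; y \<in> zip_space S \<tau>;
    \<And>i. \<bar>i\<bar> \<le> int m \<Longrightarrow> x i = y i\<rbrakk> \<Longrightarrow> zip_dist S x y < \<epsilon>"
proof (cases "card S = 1")
  case True
  then obtain a where S: "S = {a}" by (auto simp: card_1_singleton_iff)
  have "x = zip_point \<tau> (\<lambda>_. a)" if "x \<in> zip_space S \<tau>" for x
    using that by (auto simp: zip_space_def zip_point_def S fun_eq_iff)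
  then have "zip_dist S x y = 0" if "x \<in> zip_space S \<tau>" "y \<in> zip_space S \<tau>" for x y
    using that by (metis agreement_index_def enat.simps(5) zip_dist_def)
  with assms(2) show thesis by (intro that[of 0]) simp
next
  case False
  with assms(1) have gt1: "1 < real (card S)" by linarith
  then obtain m where m: "1 / \<epsilon> < real (card S) ^ m"
    using real_arch_pow by blast
  show thesis
  proof (rule that[of m])
    fix x y :: "int \<Rightarrow> 's + 'z"
    assume agree: "\<And>i. \<bar>i\<bar> \<le> int m \<Longrightarrow> x i = y i"
    show "zip_dist S x y < \<epsilon>"
    proof (cases "x = y")
      case True
      then show ?thesis using assms(2) by (simp add: zip_dist_def agreement_index_def)
    next
      case False
      then obtain i where i: "x i \<noteq> y i" "agreement_index x y = enat (nat \<bar>i\<bar>)"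
        by (rule agreement_index_attained)
      with agree have "m \<le> nat \<bar>i\<bar>" by (meson nat_le_iff nle_le)
      then have "real (card S) ^ m \<le> real (card S) ^ nat \<bar>i\<bar>"
        using gt1 by (intro power_increasing) auto
      with m have "1 / \<epsilon> < real (card S) ^ nat \<bar>i\<bar>" by linarith
      then show ?thesis using i assms gt1 by (simp add: zip_dist_def field_simps)
    qed
  qed
qed

section \<open>Orbits of zip points\<close>

text \<open>
  Lifting a point to a sequence over \<open>S\<close> turns the zip shift into the ordinary, invertible, two-sided
  shift. This makes forward orbits explicit and provides preimages of every order.
\<close>

lemma zip_shift_zip_point:
  "zip_shift \<tau> (zip_point \<tau> t) = zip_point \<tau> (\<lambda>i. t (i + 1))"
  by (auto simp: zip_shift_def zip_point_def fun_eq_iff)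

lemma funpow_zip_shift_zip_point:
  "(zip_shift \<tau> ^^ k) (zip_point \<tau> t) = zip_point \<tau> (\<lambda>i. t (i + int k))"
  by (induction k) (simp_all add: zip_shift_zip_point algebra_simps)

lemma zip_point_in_int_iterate:
  assumes "\<And>i. t i \<in> S"
  shows "zip_point \<tau> (\<lambda>i. t (n + i)) \<in>
    int_iterate (zip_space S \<tau>) (zip_shift \<tau>) n (zip_point \<tau> t)"
proof (cases "n \<ge> 0")
  case True
  then show ?thesis
    by (simp add: int_iterate_def funpow_zip_shift_zip_point add.commute)
next
  case False
  have "zip_point \<tau> (\<lambda>i. t (n + i)) \<in> zip_space S \<tau>"
    using assms by (auto simp: zip_space_def)
  with False show ?thesis
    by (simp add: int_iterate_def funpow_zip_shift_zip_point)
qed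

lemma zip_space_entry_0:
  assumes "x \<in> zip_space S \<tau>"
  shows "projl (x 0) \<in> S" and "x 0 = Inl (projl (x 0))"
  using assms by (auto simp: zip_space_def zip_point_def)

section \<open>Shadowing\<close>

text \<open>
  Both halves follow an entry to index \<open>0\<close> by induction on its distance from there. A nonnegative
  index decreases as time advances; a negative index increases as time goes back, and the
  last step crosses from \<open>- 1\<close> to \<open>0\<close>, where the zip shift applies \<open>\<tau>\<close>.
\<close>

lemma pseudo_orbit_entries:
  fixes x :: "int \<Rightarrow> int \<Rightarrow> 's + 'z"
  assumes space: "\<And>n. x n \<in> zip_space S \<tau>"
    and agree: "\<And>n i. \<bar>i\<bar> \<le> int m \<Longrightarrow> zip_shift \<tau> (x n) i = x (n + 1) i"
    and "\<bar>i\<bar> \<le> int m"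
  shows "zip_point \<tau> (\<lambda>i. projl (x (n + i) 0)) i = x n i"
proof -
  have fwd: "x n (int j) = Inl (projl (x (n + int j) 0))" if "j \<le> m" for j n
    using that
  proof (induction j arbitrary: n)
    case 0
    show ?case using zip_space_entry_0(2)[OF space] by simp
  next
    case (Suc j)
    have "x n (int (Suc j)) = zip_shift \<tau> (x n) (int j)"
      by (simp add: zip_shift_def add.commute)
    also have "\<dots> = x (n + 1) (int j)" using Suc.prems by (intro agree) simp
    also have "\<dots> = Inl (projl (x (n + 1 + int j) 0))" using Suc by simp
    finally show ?case by (simp add: algebra_simps)
  qed
  have bwd: "x n (- int (Suc j)) = Inr (\<tau> (projl (x (n - int (Suc j)) 0)))"
    if "Suc j \<le> m" for j n
    using that
  proof (induction j arbitrary: n)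
    case 0
    then show ?case using agree[of "- 1" "n - 1"] by (simp add: zip_shift_def)
  next
    case (Suc j)
    have "x n (- int (Suc (Suc j))) = zip_shift \<tau> (x (n - 1)) (- int (Suc (Suc j)))"
      using Suc.prems agree[of "- int (Suc (Suc j))" "n - 1"] by simp
    also have "\<dots> = x (n - 1) (- int (Suc j))" by (simp add: zip_shift_def)
    also have "\<dots> = Inr (\<tau> (projl (x (n - 1 - int (Suc j)) 0)))" using Suc by simp
    finally show ?case by (simp add: algebra_simps)
  qed
  show ?thesis
  proof (cases "i \<ge> 0")
    case True
    with fwd[of "nat i" n] assms(3) show ?thesis by (simp add: zip_point_def)
  next
    case False
    define j where "j = nat (- i) - 1"
    with False have i: "i = - int (Suc j)" by linarith
    then have "n - int (Suc j) = n + i" and "Suc j \<le> m" using assms(3) by linarith+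
    then have "x n i = Inr (\<tau> (projl (x (n + i) 0)))"
      using bwd[of j n] i by (simp only:)
    with False show ?thesis by (simp add: zip_point_def)
  qed
qed

theorem shadowing_property_zip_shift:
  fixes S :: "'s set" and \<tau> :: "'s \<Rightarrow> 'z"
  assumes "0 < card S"
  shows "shadowing_property (zip_space S \<tau>) (zip_dist S) (zip_shift \<tau>)"
  unfolding shadowing_property_def
proof (intro allI impI)
  fix \<epsilon> :: real
  assume "0 < \<epsilon>"
  with assms obtain m where close: "\<And>x y. \<lbrakk>x \<in> zip_space S \<tau>; y \<in> zip_space S \<tau>;
      \<And>i. \<bar>i\<bar> \<le> int m \<Longrightarrow> x i = y i\<rbrakk> \<Longrightarrow> zip_dist S x y < \<epsilon>"
    by (rule agree_imp_zip_dist_less[where \<tau> = \<tau>]) blast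
  show "\<exists>\<delta>>0. \<forall>x. pseudo_orbit (zip_space S \<tau>) (zip_dist S) (zip_shift \<tau>) \<delta> x \<longrightarrow>
      (\<exists>y\<in>zip_space S \<tau>. traced_by (zip_space S \<tau>) (zip_dist S) (zip_shift \<tau>) \<epsilon> x y)"
  proof (intro exI[of _ "1 / real (card S) ^ m"] conjI allI impI)
    show "0 < 1 / real (card S) ^ m" using assms by simp
  next
    fix x
    assume "pseudo_orbit (zip_space S \<tau>) (zip_dist S) (zip_shift \<tau>) (1 / real (card S) ^ m) x"
    then have space: "\<And>n. x n \<in> zip_space S \<tau>"
      and step: "\<And>n. zip_dist S (zip_shift \<tau> (x n)) (x (n + 1)) < 1 / real (card S) ^ m"
      by (auto simp: pseudo_orbit_def)
    have agree: "zip_shift \<tau> (x n) i = x (n + 1) i" if "\<bar>i\<bar> \<le> int m" for n i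
      using zip_dist_less_imp_agree[OF assms step that] .
    define s where "s n = projl (x n 0)" for n
    have s: "s n \<in> S" for n
      unfolding s_def using space by (rule zip_space_entry_0(1))
    have "zip_dist S (zip_point \<tau> (\<lambda>i. s (n + i))) (x n) < \<epsilon>" for n
    proof (rule close)
      show "zip_point \<tau> (\<lambda>i. s (n + i)) \<in> zip_space S \<tau>"
        using s by (auto simp: zip_space_def)
      show "x n \<in> zip_space S \<tau>" by (rule space)
      show "zip_point \<tau> (\<lambda>i. s (n + i)) i = x n i" if "\<bar>i\<bar> \<le> int m" for i
        unfolding s_def using space agree that by (rule pseudo_orbit_entries)
    qed
    then have "traced_by (zip_space S \<tau>) (zip_dist S) (zip_shift \<tau>) \<epsilon> x (zip_point \<tau> s)"
      unfolding traced_by_def using zip_point_in_int_iterate[of s S \<tau>] s by blast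
    moreover have "zip_point \<tau> s \<in> zip_space S \<tau>"
      using s by (auto simp: zip_space_def)
    ultimately show "\<exists>y\<in>zip_space S \<tau>.
        traced_by (zip_space S \<tau>) (zip_dist S) (zip_shift \<tau>) \<epsilon> x y"
      by blast
  qed
qed

theorem theorem2p26:
  fixes Z :: "'z set" and S :: "nat set" and N k :: nat and \<tau> :: "nat \<Rightarrow> 'z"
  assumes "finite Z" and "card Z = k" and "1 \<le> k"
    and "S = {0..<N}" and "k \<le> N"
    and "\<tau> ` S = Z"
  shows "shadowing_property (zip_space S \<tau>) (zip_dist S) (zip_shift \<tau>)"
proof (rule shadowing_property_zip_shift)
  show "0 < card S" using assms by simp
qed

end
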